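(* Let $\mathbb{K}$ be a field, let $V$ be a vector space over $\mathbb{K}$ with finite positive dimension, let $A, A^*$ be a Leonard pair on $V$, and let $d=\dim V-1$. Fix a basis $v^*_0,\ldots,v^*_d$ of $V$ with respect to which $A$ is irreducible tridiagonal, with $(i-1,i)$-entries $b_{i-1}$ and $(i,i-1)$-entries $c_i$ ($1\le i\le d$), and $A^*$ is $\mathrm{diag}(\theta^*_0,\ldots,\theta^*_d)$. Fix a basis $v_0,\ldots,v_d$ of $V$ with respect to which $A^*$ is irreducible tridiagonal, with $(i-1,i)$-entries $b^*_{i-1}$ and $(i,i-1)$-entries $c^*_i$ ($1\le i\le d$), and $A$ is $\mathrm{diag}(\theta_0,\ldots,\theta_d)$. Suppose $d$ is odd. Then $$\det(AA^*-A^*A)=\prod_{\substack{1\le i\le d\\ i\text{ odd}}} b_{i-1}c_i(\theta^*_{i-1}-\theta^*_i)^2,$$ $$\det(AA^*-A^*A)=\prod_{\substack{1\le i\le d\\ i\text{ odd}}} b^*_{i-1}c^*_i(\theta_{i-1}-\theta_i)^2.$$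
   Context: A square matrix is tridiagonal if each nonzero entry lies on the diagonal, the subdiagonal or the superdiagonal; a tridiagonal matrix is irreducible if each entry on the subdiagonal is nonzero and each entry on the superdiagonal is nonzero. A Leonard pair on $V$ is an ordered pair of linear transformations $A:V\to V$ and $A^*:V\to V$ such that: (i) there exists a basis for $V$ with respect to which the matrix representing $A$ is irreducible tridiagonal and the matrix representing $A^*$ is diagonal; (ii) there exists a basis for $V$ with respect to which the matrix representing $A^*$ is irreducible tridiagonal and the matrix representing $A$ is diagonal. Here $A^*$ is just a name for a second linear transformation; it does not denote the conjugate-transpose or adjoint of $A$. Rows and columns of $(d+1)\times(d+1)$ matrices are indexed by $0,1,\ldots,d$. A matrix $Y$ represents $X:V\to V$ with respect to a basis $u_0,\ldots,u_d$ if $Xu_j=\sum_{i=0}^d Y_{ij}u_i$ for $0\le j\le d$. It is known that $\theta_0,\ldots,\theta_d$ are mutually distinct and $\theta^*_0,\ldots,\theta^*_d$ are mutually distinct. *)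

theory Defs
  imports Complex_Main "Jordan_Normal_Form.Determinant"
begin

definition tridiagonal_mat :: "'a::zero mat \<Rightarrow> bool" where
  "tridiagonal_mat M \<longleftrightarrow> square_mat M \<and>
     (\<forall>i<dim_row M. \<forall>j<dim_col M. M $$ (i, j) \<noteq> 0 \<longrightarrow> i = j \<or> i = Suc j \<or> j = Suc i)"

definition irreducible_tridiagonal_mat :: "'a::zero mat \<Rightarrow> bool" where
  "irreducible_tridiagonal_mat M \<longleftrightarrow> tridiagonal_mat M \<and>
     (\<forall>i. Suc i < dim_row M \<longrightarrow> M $$ (Suc i, i) \<noteq> 0 \<and> M $$ (i, Suc i) \<noteq> 0)"

text \<open>The vector space is the whole type \<open>'v\<close>. An ordered basis of length \<open>n\<close> is
  \<open>u 0, \<dots>, u (n - 1)\<close>; the values of \<open>u\<close> at indices \<open>\<ge> n\<close> are irrelevant.\<close>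

definition ordered_basis ::
  "('k::field \<Rightarrow> 'v::ab_group_add \<Rightarrow> 'v) \<Rightarrow> nat \<Rightarrow> (nat \<Rightarrow> 'v) \<Rightarrow> bool" where
  "ordered_basis scale n u \<longleftrightarrow>
     inj_on u {..<n} \<and> \<not> module.dependent scale (u ` {..<n}) \<and> module.span scale (u ` {..<n}) = UNIV"

definition represents ::
  "('k::field \<Rightarrow> 'v::ab_group_add \<Rightarrow> 'v) \<Rightarrow> nat \<Rightarrow> (nat \<Rightarrow> 'v) \<Rightarrow> 'k mat \<Rightarrow> ('v \<Rightarrow> 'v) \<Rightarrow> bool" where
  "represents scale n u Y X \<longleftrightarrow>
     Y \<in> carrier_mat n n \<and> (\<forall>j<n. X (u j) = (\<Sum>i<n. scale (Y $$ (i, j)) (u i)))"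

definition Leonard_pair ::
  "('k::field \<Rightarrow> 'v::ab_group_add \<Rightarrow> 'v) \<Rightarrow> ('v \<Rightarrow> 'v) \<Rightarrow> ('v \<Rightarrow> 'v) \<Rightarrow> bool" where
  "Leonard_pair scale A A' \<longleftrightarrow>
     Vector_Spaces.linear scale scale A \<and> Vector_Spaces.linear scale scale A' \<and>
     (\<exists>n u M D. ordered_basis scale n u \<and> represents scale n u M A \<and> represents scale n u D A' \<and>
        irreducible_tridiagonal_mat M \<and> diagonal_mat D) \<and>
     (\<exists>n u M D. ordered_basis scale n u \<and> represents scale n u M A' \<and> represents scale n u D A \<and>
        irreducible_tridiagonal_mat M \<and> diagonal_mat D)"

text \<open>The determinant of an endomorphism is that of any matrix representing it; for linear maps
  on finite-dimensional spaces, \<open>lin_det_eq\<close> below shows independence of the basis.\<close>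

definition lin_det ::
  "('k::field \<Rightarrow> 'v::ab_group_add \<Rightarrow> 'v) \<Rightarrow> ('v \<Rightarrow> 'v) \<Rightarrow> 'k" where
  "lin_det scale X =
     (THE x. \<exists>n u Y. ordered_basis scale n u \<and> represents scale n u Y X \<and> x = det Y)"

context vector_space
begin

lemma ordered_basis_length:
  assumes "ordered_basis scale n u"
  shows "n = dim UNIV"
proof -
  have "dim UNIV = card (u ` {..<n})"
    using assms unfolding ordered_basis_def by (intro dim_eq_card) auto
  also have "\<dots> = n"
    using assms unfolding ordered_basis_def by (simp add: card_image)
  finally show ?thesis by simp
qed

lemma ordered_basis_unique_coords:
  assumes u: "ordered_basis scale n u"
    and eq: "(\<Sum>i<n. scale (a i) (u i)) = (\<Sum>i<n. scale (b i) (u i))" and i: "i < n"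
  shows "a i = b i"
proof -
  have inj: "inj_on u {..<n}" and ind: "independent (u ` {..<n})"
    using u by (auto simp: ordered_basis_def)
  define c where "c v = a (the_inv_into {..<n} u v) - b (the_inv_into {..<n} u v)" for v
  have c: "c (u i) = a i - b i" if "i < n" for i
    using the_inv_into_f_f[OF inj] that by (simp add: c_def)
  have "(\<Sum>v\<in>u ` {..<n}. scale (c v) v) = (\<Sum>i<n. scale (c (u i)) (u i))"
    by (simp add: sum.reindex[OF inj])
  also have "\<dots> = (\<Sum>i<n. scale (a i) (u i) - scale (b i) (u i))"
    by (rule sum.cong) (auto simp: c scale_left_diff_distrib)
  also have "\<dots> = 0" using eq by (simp add: sum_subtractf)
  finally have "c (u i) = 0"
    using i by (intro independentD[OF ind _ subset_refl]) auto
  thus ?thesis using c[OF i] by simp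
qed

lemma ordered_basis_coords:
  assumes u: "ordered_basis scale n u"
  shows "\<exists>P \<in> carrier_mat n m. \<forall>j<m. w j = (\<Sum>i<n. scale (P $$ (i, j)) (u i))"
proof -
  have inj: "inj_on u {..<n}" and "span (u ` {..<n}) = UNIV"
    using u by (auto simp: ordered_basis_def)
  hence "\<exists>a. x = (\<Sum>v\<in>u ` {..<n}. scale (a v) v)" for x
    using span_finite[of "u ` {..<n}"] by auto
  then obtain a where a: "\<And>x. x = (\<Sum>v\<in>u ` {..<n}. scale (a x v) v)" by metis
  have "w j = (\<Sum>i<n. scale (a (w j) (u i)) (u i))" for j
    using a[of "w j"] by (simp add: sum.reindex[OF inj])
  thus ?thesis
    by (intro bexI[of _ "Matrix.mat n m (\<lambda>(i, j). a (w j) (u i))"]) auto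
qed

lemma scale_sum_sum:
  assumes "M \<in> carrier_mat n n" "N \<in> carrier_mat n n" "j < n"
  shows "(\<Sum>k<n. scale (N $$ (k, j)) (\<Sum>i<n. scale (M $$ (i, k)) (u i))) =
         (\<Sum>i<n. scale ((M * N) $$ (i, j)) (u i))"
proof -
  have "(\<Sum>k<n. scale (N $$ (k, j)) (\<Sum>i<n. scale (M $$ (i, k)) (u i))) =
        (\<Sum>i<n. \<Sum>k<n. scale (M $$ (i, k) * N $$ (k, j)) (u i))"
    by (subst sum.swap) (simp add: scale_sum_right mult.commute)
  also have "\<dots> = (\<Sum>i<n. scale ((M * N) $$ (i, j)) (u i))"
    using assms
    by (intro sum.cong refl)
      (auto simp: scalar_prod_def scale_sum_left[symmetric] atLeast0LessThan)
  finally show ?thesis .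
qed

lemma represents_det_unique:
  assumes X: "Vector_Spaces.linear scale scale X"
    and u: "ordered_basis scale n u" and Y: "represents scale n u Y X"
    and w: "ordered_basis scale m w" and Z: "represents scale m w Z X"
  shows "det Z = det Y"
proof -
  interpret X: Vector_Spaces.linear scale scale X by fact
  have m: "m = n" using ordered_basis_length[OF u] ordered_basis_length[OF w] by simp
  have cY: "Y \<in> carrier_mat n n" and cZ: "Z \<in> carrier_mat n n"
    using Y Z by (auto simp: represents_def m)
  obtain P where P: "P \<in> carrier_mat n n"
    and Pw: "\<And>j. j < n \<Longrightarrow> w j = (\<Sum>i<n. scale (P $$ (i, j)) (u i))"
    using ordered_basis_coords[OF u, of n w] by blast
  obtain Q where Q: "Q \<in> carrier_mat n n"
    and Qu: "\<And>j. j < n \<Longrightarrow> u j = (\<Sum>i<n. scale (Q $$ (i, j)) (w i))"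
    using ordered_basis_coords[OF w, of n u] unfolding m by blast
  have PQ: "P * Q = 1\<^sub>m n"
  proof (rule eq_matI)
    fix i j assume "i < dim_row (1\<^sub>m n :: 'a mat)" "j < dim_col (1\<^sub>m n :: 'a mat)"
    hence ij: "i < n" "j < n" by auto
    have "(\<Sum>i<n. scale ((P * Q) $$ (i, j)) (u i)) =
          (\<Sum>k<n. scale (Q $$ (k, j)) (\<Sum>i<n. scale (P $$ (i, k)) (u i)))"
      using scale_sum_sum[OF P Q ij(2)] by simp
    also have "\<dots> = (\<Sum>k<n. scale (Q $$ (k, j)) (w k))"
      by (intro sum.cong refl) (simp add: Pw[symmetric])
    also have "\<dots> = u j" using Qu[OF ij(2)] by simp
    also have "\<dots> = (\<Sum>i<n. if i = j then u i else 0)" using ij by simp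
    also have "\<dots> = (\<Sum>i<n. scale ((1\<^sub>m n :: 'a mat) $$ (i, j)) (u i))"
      using ij by (intro sum.cong) auto
    finally show "(P * Q) $$ (i, j) = 1\<^sub>m n $$ (i, j)"
      by (rule ordered_basis_unique_coords[OF u _ ij(1)])
  qed (use P Q in auto)
  have YP: "Y * P = P * Z"
  proof (rule eq_matI)
    fix i j assume "i < dim_row (P * Z)" "j < dim_col (P * Z)"
    hence ij: "i < n" "j < n" using P cZ by auto
    have "(\<Sum>i<n. scale ((Y * P) $$ (i, j)) (u i)) =
          (\<Sum>k<n. scale (P $$ (k, j)) (\<Sum>i<n. scale (Y $$ (i, k)) (u i)))"
      using scale_sum_sum[OF cY P ij(2)] by simp
    also have "\<dots> = (\<Sum>k<n. scale (P $$ (k, j)) (X (u k)))"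
      using Y by (intro sum.cong refl) (simp add: represents_def)
    also have "\<dots> = X (w j)" using Pw[OF ij(2)] by (simp add: X.sum X.scale)
    also have "\<dots> = (\<Sum>k<n. scale (Z $$ (k, j)) (w k))"
      using Z ij by (simp add: represents_def m)
    also have "\<dots> = (\<Sum>k<n. scale (Z $$ (k, j)) (\<Sum>i<n. scale (P $$ (i, k)) (u i)))"
      by (intro sum.cong refl) (simp add: Pw[symmetric])
    also have "\<dots> = (\<Sum>i<n. scale ((P * Z) $$ (i, j)) (u i))"
      by (rule scale_sum_sum[OF P cZ ij(2)])
    finally show "(Y * P) $$ (i, j) = (P * Z) $$ (i, j)"
      by (rule ordered_basis_unique_coords[OF u _ ij(1)])
  qed (use P cY cZ in auto)
  have "det P * det Q = 1" using PQ det_mult[OF P Q] by simp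
  hence "det P \<noteq> 0" by auto
  moreover have "det Y * det P = det P * det Z"
    using YP det_mult[OF cY P] det_mult[OF P cZ] by metis
  ultimately show ?thesis by auto
qed

lemma lin_det_eq:
  assumes "Vector_Spaces.linear scale scale X" "ordered_basis scale n u" "represents scale n u Y X"
  shows "lin_det scale X = det Y"
  unfolding lin_det_def using assms represents_det_unique by (intro the_equality) blast+

end

end

theory Submission
  imports Defs
begin

text \<open>In a basis that makes one of the two maps tridiagonal, with matrix \<open>T\<close>, and the other
  diagonal, with matrix \<open>D = diag(t\<^sub>0, \<dots>, t\<^sub>d)\<close>, the commutator \<open>TD - DT\<close> has
  \<open>(i, j)\<close>-entry \<open>T\<^sub>i\<^sub>j (t\<^sub>j - t\<^sub>i)\<close>. It is therefore again tridiagonal, and its diagonal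
  vanishes.

  The determinant of such a matrix is a signed sum over permutations of the indices that move every
  index to a neighbour. The index \<open>0\<close> can only be exchanged with \<open>1\<close>, then \<open>2\<close> with \<open>3\<close>, and so
  on; for an even number \<open>d + 1\<close> of indices a single permutation remains. Its cycles
  \<open>(i - 1 i)\<close>, \<open>i\<close> odd, contribute one factor
  \<open>- T\<^sub>i\<^sub>-\<^sub>1\<^sub>,\<^sub>i (t\<^sub>i - t\<^sub>i\<^sub>-\<^sub>1) T\<^sub>i\<^sub>,\<^sub>i\<^sub>-\<^sub>1 (t\<^sub>i\<^sub>-\<^sub>1 - t\<^sub>i)\<close> each, which is
  the factor of the asserted product. The lemma \<open>det_hollow_tridiagonal\<close> carries this out by
  cofactor expansion. Since the factors are quadratic in the differences, \<open>DT - TD\<close> has the same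
  determinant, and so the two bases of a Leonard pair can be treated alike.\<close>

text \<open>Row \<open>0\<close> of the matrix has its only nonzero entry in column \<open>1\<close>, and once these are struck
  out, column \<open>0\<close> has its only nonzero entry in what was row \<open>1\<close>. Two expansions thus split off the
  exchange of \<open>0\<close> and \<open>1\<close> and leave a matrix of the same kind with indices shifted by two. The
  entries are given by a function on all of \<open>\<nat> \<times> \<nat>\<close> to make this shift expressible.\<close>

lemma det_hollow_tridiagonal:
  fixes f :: "nat \<Rightarrow> nat \<Rightarrow> 'a::comm_ring_1"
  assumes "\<And>i j. i < 2 * m \<Longrightarrow> j < 2 * m \<Longrightarrow> i \<noteq> Suc j \<Longrightarrow> j \<noteq> Suc i \<Longrightarrow> f i j = 0"
  shows "det (Matrix.mat (2 * m) (2 * m) (\<lambda>(i, j). f i j)) =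
    (\<Prod>k<m. - (f (2 * k) (2 * k + 1) * f (2 * k + 1) (2 * k)))"
  using assms
proof (induction m arbitrary: f)
  case 0
  show ?case by simp
next
  case (Suc m)
  define M where "M = Matrix.mat (2 * Suc m) (2 * Suc m) (\<lambda>(i, j). f i j)"
  define N where "N = mat_delete M 0 1"
  define g where "g i j = f (i + 2) (j + 2)" for i j
  have M: "M \<in> carrier_mat (2 * Suc m) (2 * Suc m)" by (simp add: M_def)
  have N: "N \<in> carrier_mat (Suc (2 * m)) (Suc (2 * m))"
    using mat_delete_carrier[OF M, of 0 1] by (simp add: N_def)
  have N_col: "N $$ (i, 0) = f (Suc i) 0" if "i < Suc (2 * m)" for i
    using that by (simp add: N_def M_def mat_delete_def)
  have "mat_delete N 0 0 = Matrix.mat (2 * m) (2 * m) (\<lambda>(i, j). g i j)"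
    by (rule eq_matI) (auto simp: N_def M_def mat_delete_def g_def)
  also have "det \<dots> = (\<Prod>k<m. - (g (2 * k) (2 * k + 1) * g (2 * k + 1) (2 * k)))"
    by (rule Suc.IH) (auto simp: g_def intro: Suc.prems)
  finally have IH: "det (mat_delete N 0 0) =
    (\<Prod>k<m. - (g (2 * k) (2 * k + 1) * g (2 * k + 1) (2 * k)))" .
  have "det N = (\<Sum>i<Suc (2 * m). N $$ (i, 0) * cofactor N i 0)"
    by (rule laplace_expansion_column[OF N]) simp
  also have "\<dots> = (\<Sum>i\<in>{0}. N $$ (i, 0) * cofactor N i 0)"
    by (rule sum.mono_neutral_right) (auto simp: N_col Suc.prems)
  also have "\<dots> = f 1 0 * det (mat_delete N 0 0)"
    by (simp add: N_col cofactor_def)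
  finally have det_N: "det N = f 1 0 * det (mat_delete N 0 0)" .
  have "det M = (\<Sum>j<2 * Suc m. M $$ (0, j) * cofactor M 0 j)"
    by (rule laplace_expansion_row[OF M]) simp
  also have "\<dots> = (\<Sum>j\<in>{1}. M $$ (0, j) * cofactor M 0 j)"
    by (rule sum.mono_neutral_right) (auto simp: M_def Suc.prems)
  also have "\<dots> = - (f 0 1 * det N)"
    by (simp add: M_def cofactor_def N_def)
  finally show ?case
    unfolding M_def[symmetric] det_N IH prod.lessThan_Suc_shift
    by (simp add: g_def mult.assoc)
qed

lemma prod_odd_reindex:
  "(\<Prod>i | 1 \<le> i \<and> i < 2 * m \<and> odd i. h i) = (\<Prod>k<m. h (2 * k + 1))"
  for h :: "nat \<Rightarrow> 'a::comm_monoid_mult"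
proof -
  have "{i. 1 \<le> i \<and> i < 2 * m \<and> odd i} = (\<lambda>k. 2 * k + 1) ` {..<m}"
    by (auto elim!: oddE)
  thus ?thesis by (simp add: prod.reindex inj_on_def)
qed

text \<open>Both orders of the commutator are covered, because each of the two bases in a Leonard pair
  has a different member of the pair in the tridiagonal role.\<close>

lemma det_tridiagonal_diagonal_commutator:
  fixes T :: "'a::comm_ring_1 mat" and t :: "nat \<Rightarrow> 'a"
  assumes T: "T \<in> carrier_mat n n" and tri: "tridiagonal_mat T" and n: "even n"
  defines "p \<equiv> \<Prod>i | 1 \<le> i \<and> i < n \<and> odd i.
    T $$ (i - 1, i) * T $$ (i, i - 1) * (t (i - 1) - t i)\<^sup>2"
  shows "det (T * mat_diag n t - mat_diag n t * T) = p"
    and "det (mat_diag n t * T - T * mat_diag n t) = p"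
proof -
  obtain m where m: "n = 2 * m" using n by (elim evenE)
  have zero: "T $$ (i, j) = 0 \<or> i = j" if "i < 2 * m" "j < 2 * m" "i \<noteq> Suc j" "j \<noteq> Suc i"
    for i j
    using tri carrier_matD[OF T] that unfolding tridiagonal_mat_def m by metis
  have p: "p = (\<Prod>k<m. T $$ (2 * k, 2 * k + 1) * T $$ (2 * k + 1, 2 * k) *
      (t (2 * k) - t (2 * k + 1))\<^sup>2)"
    unfolding p_def m prod_odd_reindex by simp
  have "T * mat_diag n t - mat_diag n t * T =
      Matrix.mat n n (\<lambda>(i, j). T $$ (i, j) * (t j - t i))"
    using T by (intro eq_matI)
      (auto simp: mat_diag_mult_left[OF T] mat_diag_mult_right[OF T] algebra_simps)
  also have "det \<dots> = p"
    unfolding m p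
  proof (subst det_hollow_tridiagonal)
    show "T $$ (i, j) * (t j - t i) = 0" if "i < 2 * m" "j < 2 * m" "i \<noteq> Suc j" "j \<noteq> Suc i" for i j
      using zero[OF that] by auto
  qed (auto intro!: prod.cong simp: power2_eq_square algebra_simps)
  finally show "det (T * mat_diag n t - mat_diag n t * T) = p" .
  have "mat_diag n t * T - T * mat_diag n t =
      Matrix.mat n n (\<lambda>(i, j). T $$ (i, j) * (t i - t j))"
    using T by (intro eq_matI)
      (auto simp: mat_diag_mult_left[OF T] mat_diag_mult_right[OF T] algebra_simps)
  also have "det \<dots> = p"
    unfolding m p
  proof (subst det_hollow_tridiagonal)
    show "T $$ (i, j) * (t i - t j) = 0" if "i < 2 * m" "j < 2 * m" "i \<noteq> Suc j" "j \<noteq> Suc i" for i j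
      using zero[OF that] by auto
  qed (auto intro!: prod.cong simp: power2_eq_square algebra_simps)
  finally show "det (mat_diag n t * T - T * mat_diag n t) = p" .
qed

context vector_space
begin

lemma represents_mult:
  assumes X: "Vector_Spaces.linear scale scale X"
    and M: "represents scale n u M X" and N: "represents scale n u N Y"
  shows "represents scale n u (M * N) (\<lambda>x. X (Y x))"
proof -
  interpret X: Vector_Spaces.linear scale scale X by fact
  have cM: "M \<in> carrier_mat n n" and cN: "N \<in> carrier_mat n n"
    using M N by (auto simp: represents_def)
  have "X (Y (u j)) = (\<Sum>i<n. scale ((M * N) $$ (i, j)) (u i))" if j: "j < n" for j
  proof -
    have "X (Y (u j)) = (\<Sum>k<n. scale (N $$ (k, j)) (X (u k)))"
      using N j by (simp add: represents_def X.sum X.scale)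
    also have "\<dots> = (\<Sum>k<n. scale (N $$ (k, j)) (\<Sum>i<n. scale (M $$ (i, k)) (u i)))"
      using M by (intro sum.cong refl) (simp add: represents_def)
    also have "\<dots> = (\<Sum>i<n. scale ((M * N) $$ (i, j)) (u i))"
      by (rule scale_sum_sum[OF cM cN j])
    finally show ?thesis .
  qed
  thus ?thesis using cM cN by (simp add: represents_def)
qed

lemma represents_diff:
  assumes "represents scale n u M X" and "represents scale n u N Y"
  shows "represents scale n u (M - N) (\<lambda>x. X x - Y x)"
  using assms
  by (auto simp: represents_def scale_left_diff_distrib sum_subtractf[symmetric] intro!: sum.cong)

lemma lin_det_commutator:
  assumes X: "Vector_Spaces.linear scale scale X" and Y: "Vector_Spaces.linear scale scale Y"
    and u: "ordered_basis scale n u"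
    and M: "represents scale n u M X" and N: "represents scale n u N Y"
  shows "lin_det scale (\<lambda>x. X (Y x) - Y (X x)) = det (M * N - N * M)"
proof (rule lin_det_eq[OF _ u])
  interpret vector_space_pair scale scale ..
  have "Vector_Spaces.linear scale scale (X \<circ> Y)" "Vector_Spaces.linear scale scale (Y \<circ> X)"
    using X Y by (simp_all add: Vector_Spaces.linear_compose)
  thus "Vector_Spaces.linear scale scale (\<lambda>x. X (Y x) - Y (X x))"
    by (auto dest: linear_compose_sub simp: o_def)
  show "represents scale n u (M * N - N * M) (\<lambda>x. X (Y x) - Y (X x))"
    by (intro represents_diff represents_mult X Y M N)
qed

end

theorem theorem1p4:
  fixes scale :: "'k::field \<Rightarrow> 'v::ab_group_add \<Rightarrow> 'v"
    and A A' :: "'v \<Rightarrow> 'v"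
    and d :: nat
    and v v' :: "nat \<Rightarrow> 'v"
    and B B' :: "'k mat"
    and b c b' c' \<theta> \<theta>' :: "nat \<Rightarrow> 'k"
  assumes V: "vector_space scale"
    and fin: "\<exists>S. finite S \<and> module.span scale S = UNIV"
    and pos: "vector_space.dim scale UNIV > 0"
    and d: "d = vector_space.dim scale UNIV - 1"
    and LP: "Leonard_pair scale A A'"
    and v': "ordered_basis scale (d + 1) v'"
    and A_v': "represents scale (d + 1) v' B A"
    and B: "irreducible_tridiagonal_mat B"
    and B_entries: "\<forall>i\<in>{1..d}. B $$ (i - 1, i) = b (i - 1) \<and> B $$ (i, i - 1) = c i"
    and A'_v': "represents scale (d + 1) v' (mat_diag (d + 1) \<theta>') A'"
    and v: "ordered_basis scale (d + 1) v"
    and A'_v: "represents scale (d + 1) v B' A'"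
    and B': "irreducible_tridiagonal_mat B'"
    and B'_entries: "\<forall>i\<in>{1..d}. B' $$ (i - 1, i) = b' (i - 1) \<and> B' $$ (i, i - 1) = c' i"
    and A_v: "represents scale (d + 1) v (mat_diag (d + 1) \<theta>) A"
    and odd: "odd d"
  shows "lin_det scale (\<lambda>x. A (A' x) - A' (A x)) =
           (\<Prod>i | 1 \<le> i \<and> i \<le> d \<and> odd i. b (i - 1) * c i * (\<theta>' (i - 1) - \<theta>' i)\<^sup>2) \<and>
         lin_det scale (\<lambda>x. A (A' x) - A' (A x)) =
           (\<Prod>i | 1 \<le> i \<and> i \<le> d \<and> odd i. b' (i - 1) * c' i * (\<theta> (i - 1) - \<theta> i)\<^sup>2)"
proof -
  interpret vector_space scale by (fact V)
  have lin: "Vector_Spaces.linear scale scale A" "Vector_Spaces.linear scale scale A'"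
    using LP by (auto simp: Leonard_pair_def)
  have even: "even (d + 1)" using odd by simp
  have cB: "B \<in> carrier_mat (d + 1) (d + 1)" and cB': "B' \<in> carrier_mat (d + 1) (d + 1)"
    using A_v' A'_v by (auto simp: represents_def)
  have tri: "tridiagonal_mat B" "tridiagonal_mat B'"
    using B B' by (auto simp: irreducible_tridiagonal_mat_def)
  have "lin_det scale (\<lambda>x. A (A' x) - A' (A x)) =
      (\<Prod>i | 1 \<le> i \<and> i < d + 1 \<and> odd i.
        B $$ (i - 1, i) * B $$ (i, i - 1) * (\<theta>' (i - 1) - \<theta>' i)\<^sup>2)"
    unfolding lin_det_commutator[OF lin v' A_v' A'_v']
    by (rule det_tridiagonal_diagonal_commutator(1)[OF cB tri(1) even])
  also have "\<dots> = (\<Prod>i | 1 \<le> i \<and> i \<le> d \<and> odd i. b (i - 1) * c i * (\<theta>' (i - 1) - \<theta>' i)\<^sup>2)"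
    using B_entries by (intro prod.cong) auto
  finally have first: "lin_det scale (\<lambda>x. A (A' x) - A' (A x)) = \<dots>" .
  have "lin_det scale (\<lambda>x. A (A' x) - A' (A x)) =
      (\<Prod>i | 1 \<le> i \<and> i < d + 1 \<and> odd i.
        B' $$ (i - 1, i) * B' $$ (i, i - 1) * (\<theta> (i - 1) - \<theta> i)\<^sup>2)"
    unfolding lin_det_commutator[OF lin v A_v A'_v]
    by (rule det_tridiagonal_diagonal_commutator(2)[OF cB' tri(2) even])
  also have "\<dots> = (\<Prod>i | 1 \<le> i \<and> i \<le> d \<and> odd i. b' (i - 1) * c' i * (\<theta> (i - 1) - \<theta> i)\<^sup>2)"
    using B'_entries by (intro prod.cong) auto
  finally show ?thesis using first by blast
qed

end
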